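(* For every forest $F$ (finite, simple, acyclic graph), $D_t(F,-1)\in\{0,1\}$.
   Context: A set $D\subseteq V(G)$ of a finite simple graph $G$ is a total dominating set if every vertex of $G$ is adjacent to some vertex of $D$. With $d_t(G,i)$ the number of total dominating sets of size $i$, the total domination polynomial is $D_t(G,x)=\sum_{i=1}^{|V(G)|}d_t(G,i)x^i$ (so it is $0$ for the graph with no vertices). *)

theory Defs
  imports "Graph_Theory.Graph_Theory" "HOL-Computational_Algebra.Polynomial"
begin

text \<open>
  Finite simple graphs are the symmetric loop-free digraphs without parallel arcs of the locale
  \<^locale>\<open>graph\<close>: an undirected edge is a pair of opposite arcs. Traversing an edge back and forth
  is therefore a \<^const>\<open>pre_digraph.cycle\<close> of length 2, and the library predicate
  \<^const>\<open>forest\<close>, which excludes these as well, holds only for edgeless symmetric digraphs.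
  A cycle of the undirected graph is a \<^const>\<open>pre_digraph.cycle\<close> of length at least 3.
\<close>

definition undirected_forest :: "('a, 'b) pre_digraph \<Rightarrow> bool" where
  "undirected_forest G \<longleftrightarrow> graph G \<and> \<not> (\<exists>p. pre_digraph.cycle G p \<and> 3 \<le> length p)"

definition total_dominating_set :: "('a, 'b) pre_digraph \<Rightarrow> 'a set \<Rightarrow> bool" where
  "total_dominating_set G D \<longleftrightarrow> D \<subseteq> verts G \<and> (\<forall>v \<in> verts G. \<exists>u \<in> D. v \<rightarrow>\<^bsub>G\<^esub> u)"

definition num_total_dominating_sets :: "('a, 'b) pre_digraph \<Rightarrow> nat \<Rightarrow> nat" where
  "num_total_dominating_sets G i = card {D. total_dominating_set G D \<and> card D = i}"

text \<open>
  The sum starts at 1, so the null graph has polynomial 0 although the empty set is a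
  total dominating set of it.
\<close>

definition total_domination_poly :: "('a, 'b) pre_digraph \<Rightarrow> int poly" where
  "total_domination_poly G =
    (\<Sum>i = 1..card (verts G). monom (int (num_total_dominating_sets G i)) i)"

end

theory Submission
  imports Defs
begin

text \<open>
  Let \<open>S(G)\<close> be the sum of \<open>(-1)^|D|\<close> over all total dominating sets \<open>D\<close>. It vanishes if \<open>G\<close>
  has an isolated vertex. If \<open>u\<close> is a leaf with neighbour \<open>w\<close>, every total dominating set contains
  \<open>w\<close>, and \<open>u\<close> is of use only for dominating \<open>w\<close>. Hence the sets meeting \<open>N(w)\<close> outside \<open>u\<close>
  cancel in pairs by toggling \<open>u\<close>, and the others are \<open>D' \<union> {u, w}\<close> for the total dominating sets
  \<open>D'\<close> of \<open>G - N[w]\<close>. So \<open>S(G) = S(G - N[w])\<close>, and induction down to the null graph, where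
  \<open>S = 1\<close>, gives \<open>S(F) \<in> {0, 1}\<close> for every forest.
\<close>

text \<open>Unlike the polynomial at -1, this sum counts the empty set for the null graph. With
  value 1 there, the leaf recursion stays valid when deleting the closed neighbourhood of
  \<open>w\<close> leaves no vertices.\<close>

definition alternating_tds_sum :: "('a, 'b) pre_digraph \<Rightarrow> int" where
  "alternating_tds_sum G = (\<Sum>D | total_dominating_set G D. (-1) ^ card D)"

lemma finite_total_dominating_sets:
  assumes "finite (verts G)"
  shows "finite {D. total_dominating_set G D}"
  by (rule finite_subset[of _ "Pow (verts G)"]) (use assms in \<open>auto simp: total_dominating_set_def\<close>)

text \<open>A graph with a vertex is not dominated by the empty set, so starting the polynomial at
  degree 1 loses nothing. The rest is grouping the sets by size.\<close>

lemma poly_total_domination_poly: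
  assumes "finite (verts G)" and "verts G \<noteq> {}"
  shows "poly (total_domination_poly G) (-1) = alternating_tds_sum G"
proof -
  have range: "card ` {D. total_dominating_set G D} \<subseteq> {1..card (verts G)}"
  proof clarsimp
    fix D assume D: "total_dominating_set G D"
    then have "D \<subseteq> verts G" and "D \<noteq> {}"
      using assms(2) by (auto simp: total_dominating_set_def)
    then show "Suc 0 \<le> card D \<and> card D \<le> card (verts G)"
      using assms(1) by (simp add: Suc_le_eq card_gt_0_iff card_mono finite_subset)
  qed
  have "poly (total_domination_poly G) (-1) =
    (\<Sum>i = 1..card (verts G). \<Sum>D | D \<in> {D. total_dominating_set G D} \<and> card D = i. (-1) ^ card D)"
    by (simp add: total_domination_poly_def num_total_dominating_sets_def poly_sum poly_monom)
  also have "\<dots> = alternating_tds_sum G"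
    unfolding alternating_tds_sum_def
    by (rule sum.group[OF finite_total_dominating_sets[OF assms(1)] _ range]) simp
  finally show ?thesis .
qed

lemma alternating_tds_sum_null_graph:
  assumes "verts G = {}"
  shows "alternating_tds_sum G = 1"
proof -
  have "{D. total_dominating_set G D} = {{}}"
    using assms by (auto simp: total_dominating_set_def)
  then show ?thesis by (simp add: alternating_tds_sum_def)
qed

lemma alternating_tds_sum_isolated:
  assumes "u \<in> verts G" and "\<And>x. \<not> u \<rightarrow>\<^bsub>G\<^esub> x"
  shows "alternating_tds_sum G = 0"
proof -
  have "{D. total_dominating_set G D} = {}"
    using assms by (auto simp: total_dominating_set_def)
  then show ?thesis by (simp add: alternating_tds_sum_def)
qed

lemma dominates_induce_subgraph [simp]:
  "x \<rightarrow>\<^bsub>G \<restriction> W\<^esub> y \<longleftrightarrow> x \<rightarrow>\<^bsub>G\<^esub> y \<and> x \<in> W \<and> y \<in> W"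
  by (auto simp: arcs_ends_conv)

text \<open>Adding or removing \<open>u\<close> is an involution of \<open>\<A>\<close> that changes
  each finite cardinality by one, so the sum equals its own negative.\<close>

lemma sum_card_sign_toggle:
  assumes closed: "\<And>D. D \<in> \<A> \<Longrightarrow> insert u D \<in> \<A>" "\<And>D. D \<in> \<A> \<Longrightarrow> D - {u} \<in> \<A>"
    and fin: "\<And>D. D \<in> \<A> \<Longrightarrow> finite D"
  shows "(\<Sum>D\<in>\<A>. (-1) ^ card D) = (0 :: int)"
proof -
  define toggle where "toggle D = (if u \<in> D then D - {u} else insert u D)" for D
  have "(\<Sum>D\<in>\<A>. (-1) ^ card D) = (\<Sum>D\<in>\<A>. - ((-1) ^ card D) :: int)"
  proof (rule sum.reindex_bij_witness[of _ toggle toggle])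
    fix D assume D: "D \<in> \<A>"
    show "toggle (toggle D) = D" "toggle (toggle D) = D"
      by (auto simp: toggle_def)
    show "toggle D \<in> \<A>" "toggle D \<in> \<A>"
      using closed D by (auto simp: toggle_def)
    show "- ((-1) ^ card (toggle D)) = ((-1) ^ card D :: int)"
    proof (cases "u \<in> D")
      case True
      with fin[OF D] have "card D = Suc (card (toggle D))"
        by (simp add: toggle_def card_Suc_Diff1 del: card_Diff_insert)
      then show ?thesis by simp
    qed (use fin[OF D] in \<open>simp add: toggle_def\<close>)
  qed
  then show ?thesis by (simp add: sum_negf)
qed

lemma (in graph) alternating_tds_sum_leaf:
  assumes leaf: "\<And>x. u \<rightarrow>\<^bsub>G\<^esub> x \<longleftrightarrow> x = w"
  shows "alternating_tds_sum G = alternating_tds_sum (G \<restriction> (verts G - insert w {x. w \<rightarrow>\<^bsub>G\<^esub> x}))"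
    (is "_ = alternating_tds_sum ?H")
proof -
  let ?T = "{D. total_dominating_set G D}"
  \<comment> \<open>In \<open>?P\<close>, \<open>w\<close> has no dominator other than
    \<open>u\<close>; outside \<open>?P\<close>, some other neighbour of \<open>w\<close> lies in
    the set, which frees \<open>u\<close> to be toggled.\<close>
  let ?P = "{D \<in> ?T. \<forall>x\<in>D. w \<rightarrow>\<^bsub>G\<^esub> x \<longrightarrow> x = u}"
  have adj_sym: "x \<rightarrow>\<^bsub>G\<^esub> y \<longleftrightarrow> y \<rightarrow>\<^bsub>G\<^esub> x" for x y
    using sym_arcs arcs_ends_symmetric by metis
  have in_verts: "x \<in> verts G \<and> y \<in> verts G" if "x \<rightarrow>\<^bsub>G\<^esub> y" for x y
    using that by (auto simp: arcs_ends_conv)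
  have uw: "u \<rightarrow>\<^bsub>G\<^esub> w" "w \<rightarrow>\<^bsub>G\<^esub> u" "u \<in> verts G" "w \<in> verts G" "u \<noteq> w"
    using leaf adj_sym in_verts adj_not_same by blast+
  have only_w: "x = w" if "x \<rightarrow>\<^bsub>G\<^esub> u" for x
    using that leaf adj_sym by blast
  have w_in: "w \<in> D" if "total_dominating_set G D" for D
    using that uw leaf by (auto simp: total_dominating_set_def)
  have fin: "finite D" if "total_dominating_set G D" for D
    using that by (auto simp: total_dominating_set_def intro: finite_subset)
  have finT: "finite ?T"
    by (rule finite_total_dominating_sets) simp

  have "(\<Sum>D\<in>?T - ?P. (-1) ^ card D) = (0 :: int)"
  proof (rule sum_card_sign_toggle)
    fix D assume D: "D \<in> ?T - ?P"
    then obtain x where x: "x \<in> D" "w \<rightarrow>\<^bsub>G\<^esub> x" "x \<noteq> u" by auto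
    have T: "total_dominating_set G D" using D by simp
    show "insert u D \<in> ?T - ?P"
      using T x uw by (auto simp: total_dominating_set_def)
    \<comment> \<open>Only \<open>w\<close> is adjacent to \<open>u\<close>, so removing
      \<open>u\<close> can endanger only \<open>w\<close>, which \<open>x\<close> still
      dominates.\<close>
    have "\<exists>y\<in>D - {u}. v \<rightarrow>\<^bsub>G\<^esub> y" if v: "v \<in> verts G" for v
    proof (cases "v = w")
      case True
      with x show ?thesis by auto
    next
      case False
      from T v obtain y where "y \<in> D" "v \<rightarrow>\<^bsub>G\<^esub> y"
        by (auto simp: total_dominating_set_def)
      with False only_w show ?thesis by blast
    qed
    then show "D - {u} \<in> ?T - ?P"
      using T x by (auto simp: total_dominating_set_def)
    show "finite D" using T by (rule fin)
  qed
  moreover have "(\<Sum>D\<in>?P. (-1) ^ card D) = alternating_tds_sum ?H"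
    unfolding alternating_tds_sum_def
  proof (rule sum.reindex_bij_witness[of _ "\<lambda>D. insert u (insert w D)" "\<lambda>D. D - {u, w}"])
    fix D assume D: "D \<in> ?P"
    then have T: "total_dominating_set G D" and P: "\<And>x. x \<in> D \<Longrightarrow> w \<rightarrow>\<^bsub>G\<^esub> x \<Longrightarrow> x = u" by auto
    have "u \<in> D"
      using T P uw by (auto simp: total_dominating_set_def)
    with w_in[OF T] show eq: "insert u (insert w (D - {u, w})) = D" by auto
    \<comment> \<open>A dominator \<open>y\<close> of \<open>v\<close> survives in
      \<open>?H\<close>: it is neither \<open>u\<close> nor \<open>w\<close> because
      \<open>v\<close> is not in the closed neighbourhood of \<open>w\<close>, and it is no other
      neighbour of \<open>w\<close> by \<open>P\<close>.\<close>
    have "\<exists>y\<in>D - {u, w}. v \<rightarrow>\<^bsub>?H\<^esub> y" if v: "v \<in> verts ?H" for v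
    proof -
      from T v obtain y where y: "y \<in> D" "v \<rightarrow>\<^bsub>G\<^esub> y"
        by (auto simp: total_dominating_set_def)
      moreover have "y \<noteq> u" "y \<noteq> w" using v y only_w adj_sym by auto
      ultimately show ?thesis using v P in_verts by auto
    qed
    then show "D - {u, w} \<in> {D. total_dominating_set ?H D}"
      using T P by (auto simp: total_dominating_set_def)
    have "card D = Suc (Suc (card (D - {u, w})))"
      using fin[OF T] uw(5) by (subst eq[symmetric]) simp
    then show "(-1) ^ card (D - {u, w}) = ((-1) ^ card D :: int)" by simp
  next
    fix D assume "D \<in> {D. total_dominating_set ?H D}"
    then have sub: "D \<subseteq> verts G - insert w {x. w \<rightarrow>\<^bsub>G\<^esub> x}"
      and dom: "\<And>v. v \<in> verts G - insert w {x. w \<rightarrow>\<^bsub>G\<^esub> x} \<Longrightarrow> \<exists>y\<in>D. v \<rightarrow>\<^bsub>G\<^esub> y"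
      by (auto simp: total_dominating_set_def)
    show "insert u (insert w D) - {u, w} = D"
      using sub uw by auto
    \<comment> \<open>Here \<open>u\<close> dominates \<open>w\<close>, \<open>w\<close> dominates
      its neighbours, and \<open>D\<close> dominates the remaining vertices.\<close>
    have "\<exists>y\<in>insert u (insert w D). v \<rightarrow>\<^bsub>G\<^esub> y" if "v \<in> verts G" for v
      using that dom[of v] uw adj_sym by auto
    then show "insert u (insert w D) \<in> ?P"
      using sub uw adj_not_same by (auto simp: total_dominating_set_def)
  qed
  moreover have "alternating_tds_sum G = (\<Sum>D\<in>?T - ?P. (-1) ^ card D) + (\<Sum>D\<in>?P. (-1) ^ card D)"
    unfolding alternating_tds_sum_def by (rule sum.subset_diff[OF _ finT]) auto
  ultimately show ?thesis by simp
qed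

lemma undirected_forest_induce_subgraph:
  assumes "undirected_forest G" and "W \<subseteq> verts G"
  shows "undirected_forest (G \<restriction> W)"
proof -
  interpret graph G using assms(1) by (simp add: undirected_forest_def)
  have ind: "induced_subgraph (G \<restriction> W) G"
    using assms(2) by (rule induced_induce)
  interpret H: digraph "G \<restriction> W"
    using ind by (rule digraphI_induced)
  have "graph (G \<restriction> W)"
    using induced_graph_imp_symmetric[OF sym_arcs ind] by (rule H.graphI)
  then show ?thesis
    using assms(1) subgraph_cycle[OF induced_imp_subgraph[OF ind]]
    by (auto simp: undirected_forest_def)
qed

text \<open>
  The start of a longest path has all its neighbours on the path, and a neighbour beyond the
  second vertex would close a cycle.
\<close>
lemma undirected_forest_leaf_or_isolated:
  assumes "undirected_forest G" and "verts G \<noteq> {}"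
  obtains u where "u \<in> verts G" and "\<And>x y. u \<rightarrow>\<^bsub>G\<^esub> x \<Longrightarrow> u \<rightarrow>\<^bsub>G\<^esub> y \<Longrightarrow> x = y"
proof -
  interpret graph G using assms(1) by (simp add: undirected_forest_def)
  from assms(2) obtain v\<^sub>0 where "v\<^sub>0 \<in> verts G" by blast
  then have "apath v\<^sub>0 [] v\<^sub>0" by (simp add: apath_Nil_iff)
  \<comment> \<open>A longest path exists because the trivial path is one and every path has fewer
    arcs than \<open>G\<close> has vertices.\<close>
  then have "\<exists>p. (\<exists>u v. apath u p v) \<and> (\<forall>q. (\<exists>u v. apath u q v) \<longrightarrow> length q \<le> length p)"
    by (intro ex_has_greatest_nat[where b = "card (verts G)"]) (use length_apath_less in auto)
  then obtain u p v where p: "apath u p v"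
    and longest: "\<And>u' q v'. apath u' q v' \<Longrightarrow> length q \<le> length p" by blast
  have on_path: "x = head G (hd p) \<and> p \<noteq> []" if "u \<rightarrow>\<^bsub>G\<^esub> x" for x
  proof (rule ccontr)
    assume not_second: "\<not> ?thesis"
    have "x \<rightarrow>\<^bsub>G\<^esub> u" using that sym_arcs arcs_ends_symmetric by metis
    then obtain e where e: "e \<in> arcs G" "tail G e = x" "head G e = u" by auto
    have "x \<noteq> u" using that adj_not_same by blast
    have "x \<in> set (awalk_verts u p)"
    \<comment> \<open>Otherwise prepending \<open>e\<close> would give a longer path.\<close>
    proof (rule ccontr)
      assume "x \<notin> set (awalk_verts u p)"
      then have "apath x (e # p) v" using e p by (simp add: apath_Cons_iff)
      from longest[OF this] show False by simp
    qed
    moreover have "awalk u p v" using p by (simp add: apath_def)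
    ultimately obtain q r where qr: "p = q @ r" "awalk u q x"
      using awalk_decomp by blast
    \<comment> \<open>Together with \<open>e\<close> this gives length at least 3, so that the
      closed walk is not an edge traversed back and forth.\<close>
    have "2 \<le> length q"
    proof -
      have "q \<noteq> []" using qr \<open>x \<noteq> u\<close> by (auto simp: awalk_Nil_iff)
      moreover have "q \<noteq> [a]" for a
        using qr not_second by (auto simp: awalk_simps)
      ultimately show ?thesis
        by (cases q rule: remdups_adj.cases) auto
    qed
    moreover have "cycle (e # q)"
      unfolding cycle_def
    proof (intro exI conjI)
      show "awalk x (e # q) x" using e qr by (simp add: awalk_Cons_iff)
      \<comment> \<open>As an initial segment of the path \<open>p\<close>, \<open>q\<close> repeats
        no vertex; its vertices are those of \<open>e # q\<close> after the starting
        \<open>x\<close>.\<close>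
      have "apath u q (awlast u q)" using p qr(1) by (simp add: apath_append_iff)
      then show "distinct (tl (awalk_verts x (e # q)))" using e by (simp add: apath_def)
    qed simp
    ultimately show False
      using assms(1) by (auto simp: undirected_forest_def dest!: spec[of _ "e # q"])
  qed
  moreover have "u \<in> verts G" using p by (auto simp: apath_def)
  ultimately show ?thesis by (metis that)
qed

lemma alternating_tds_sum_forest:
  assumes "undirected_forest G"
  shows "alternating_tds_sum G \<in> {0, 1}"
  using assms
proof (induction "card (verts G)" arbitrary: G rule: less_induct)
  case less
  interpret graph G using less.prems by (simp add: undirected_forest_def)
  show ?case
  proof (cases "verts G = {}")
    case True
    then show ?thesis by (simp add: alternating_tds_sum_null_graph)
  next
    case False
    then obtain u where u: "u \<in> verts G" "\<And>x y. u \<rightarrow>\<^bsub>G\<^esub> x \<Longrightarrow> u \<rightarrow>\<^bsub>G\<^esub> y \<Longrightarrow> x = y"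
      using undirected_forest_leaf_or_isolated[OF less.prems] by blast
    show ?thesis
    \<comment> \<open>Since \<open>u\<close> has at most one neighbour, it is either isolated or a
      leaf.\<close>
    proof (cases "\<exists>w. u \<rightarrow>\<^bsub>G\<^esub> w")
      case False
      then show ?thesis using alternating_tds_sum_isolated[OF u(1)] by simp
    next
      case True
      then obtain w where w: "u \<rightarrow>\<^bsub>G\<^esub> w" by blast
      let ?W = "verts G - insert w {x. w \<rightarrow>\<^bsub>G\<^esub> x}"
      have "w \<in> verts G" using w by (auto simp: arcs_ends_conv)
      then have "card ?W < card (verts G)"
        by (intro psubset_card_mono) auto
      moreover have "undirected_forest (G \<restriction> ?W)"
        by (rule undirected_forest_induce_subgraph[OF less.prems]) auto
      ultimately have "alternating_tds_sum (G \<restriction> ?W) \<in> {0, 1}"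
        using less.hyps by simp
      moreover have "alternating_tds_sum G = alternating_tds_sum (G \<restriction> ?W)"
        using u(2) w by (intro alternating_tds_sum_leaf) blast
      ultimately show ?thesis by simp
    qed
  qed
qed

theorem theorem7:
  fixes F :: "('a, 'b) pre_digraph"
  assumes "undirected_forest F"
  shows "poly (total_domination_poly F) (-1) \<in> {0, 1}"
proof (cases "verts F = {}")
  case True
  \<comment> \<open>The null graph is treated separately: its polynomial is 0, whereas its
    alternating sum is 1.\<close>
  then show ?thesis by (simp add: total_domination_poly_def)
next
  case False
  interpret graph F using assms by (simp add: undirected_forest_def)
  from False show ?thesis
    using alternating_tds_sum_forest[OF assms] by (simp add: poly_total_domination_poly)
qed

end
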